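(* For all integers $r,k\ge1$ and $m\ge0$, \[ \psi(\underbrace{1,\ldots,1}_{r-1},k;m+1)=\sum_{\substack{a_1,\ldots,a_k\ge0\\ a_1+\cdots+a_k=m}}\binom{a_k+r}{r}\,T(a_1+1,\ldots,a_{k-1}+1,a_k+r+1). \]
   Context: For integers $k_1,\ldots,k_r$ and $|z|<1$, $\mathrm{Ath}(k_1,\ldots,k_r;z)=\sum_{0<m_1<\cdots<m_r,\ m_i\equiv i \bmod 2}\frac{z^{m_r}}{m_1^{k_1}\cdots m_r^{k_r}}$ (summation variables alternately odd, even, odd, \ldots). For positive integers $k_1,\ldots,k_{r-1}$ and $s$ with $\Re s>1$, let \[T(k_1,\ldots,k_{r-1},s)=2^{r}\sum_{\substack{0<m_1<\cdots<m_r\\ m_i\equiv i\bmod 2}}\frac{1}{m_1^{k_1}\cdots m_{r-1}^{k_{r-1}}m_r^{s}},\] where $r$ is the total number of arguments. For positive integers $k_1,\ldots,k_r$ and $\Re s>0$, \[\psi(k_1,\ldots,k_r;s)=\frac{2^r}{\Gamma(s)}\int_0^\infty t^{s-1}\frac{\mathrm{Ath}(k_1,\ldots,k_r;\tanh(t/2))}{\sinh t}\,dt.\] *)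

theory Defs
  imports "HOL-Analysis.Analysis"
begin

text \<open>
  The list \<open>ms\<close> stands for \<open>(m\<^sub>1, \<dots>, m\<^sub>r)\<close>. Lists are indexed from \<open>0\<close>, so \<open>m\<^sub>i\<close> is
  \<open>ms ! (i - 1)\<close> and the condition \<open>m\<^sub>i \<equiv> i (mod 2)\<close> is shifted by one.
\<close>

definition alt_seqs :: "nat \<Rightarrow> nat list set" where
  "alt_seqs r = {ms. length ms = r \<and> sorted_wrt (<) ms \<and>
     (\<forall>i<r. 0 < ms ! i \<and> ms ! i mod 2 = Suc i mod 2)}"

definition Ath :: "int list \<Rightarrow> complex \<Rightarrow> complex" where
  "Ath ks z = (\<Sum>\<^sub>\<infinity>ms\<in>alt_seqs (length ks).
     z ^ last ms / (\<Prod>i<length ks. of_nat (ms ! i) powi (ks ! i)))"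

text \<open>
  \<open>T_fun [k\<^sub>1, \<dots>, k\<^sub>r\<^sub>-\<^sub>1] s\<close> is \<open>T(k\<^sub>1, \<dots>, k\<^sub>r\<^sub>-\<^sub>1, s)\<close>: the list excludes the last argument,
  so \<open>r\<close> is one more than its length. Meaningful for positive \<open>k\<^sub>i\<close> and \<open>Re s > 1\<close>, where
  the series converges absolutely.
\<close>

definition T_fun :: "nat list \<Rightarrow> complex \<Rightarrow> complex" where
  "T_fun ks s = (let r = length ks + 1 in
     2 ^ r * (\<Sum>\<^sub>\<infinity>ms\<in>alt_seqs r.
       1 / ((\<Prod>i<r - 1. of_nat (ms ! i) ^ (ks ! i)) * of_nat (ms ! (r - 1)) powr s)))"

text \<open>
  Meaningful for nonempty \<open>ks\<close> with positive entries and \<open>Re s > 0\<close>, where the integral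
  converges absolutely.
\<close>

definition psi_fun :: "nat list \<Rightarrow> complex \<Rightarrow> complex" where
  "psi_fun ks s = 2 ^ length ks / Gamma s *
     (CLBINT t:{0<..}. of_real t powr (s - 1) *
        Ath (map int ks) (of_real (tanh (t / 2))) / of_real (sinh t))"

end

theory Submission
  imports Defs
begin

text \<open>
  Put \<open>z = tanh (t / 2)\<close>, so that \<open>dz / z = dt / sinh t\<close> and \<open>2 dz / (1 - z\<^sup>2) = dt\<close>. With
  \<open>A\<^sub>k(t) = 2\<^sup>r Ath(1, \<dots>, 1, k; z)\<close> this gives \<open>A\<^sub>1(t) = t\<^sup>r / r!\<close> and
  \<open>A\<^sub>k\<^sub>+\<^sub>1(t) = \<integral>\<^sub>0\<^sup>t A\<^sub>k(s) ds / sinh s\<close>. By Tonelli the \<open>k - 1\<close> integrations can be moved to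
  the factor \<open>t\<^sup>m / m!\<close>, where \<open>P \<mapsto> \<integral>\<^sub>s\<^sup>\<infinity> P(t) dt / sinh t\<close> acts on functions
  \<open>(t\<^sup>b / b!) e\<^sup>-\<^sup>M\<^sup>t\<close>: expanding \<open>1 / sinh t = 2 \<Sum> e\<^sup>-\<^sup>n\<^sup>t\<close> over odd \<open>n\<close> prolongs the alternating
  sequence \<open>m\<^sub>1 < m\<^sub>2 < \<dots>\<close> by one term, and integrating by parts splits \<open>b\<close> into the next
  argument \<open>a\<^sub>i\<close> and the remaining power of \<open>s\<close>. The last integration, against
  \<open>t\<^sup>r / r!\<close>, produces the binomial coefficient. All terms are nonnegative, so the
  computation takes place in \<open>ennreal\<close> and finiteness is only needed at the end.
\<close>

subsection \<open>Sums over alternating sequences\<close>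

text \<open>
  \<open>alt_sum es f\<close> is the sum of \<open>f(m\<^sub>r) / \<Prod> m\<^sub>i ^ e\<^sub>i\<close> over \<open>alt_seqs r\<close>, see \<open>nn_integral_alt_seqs\<close>;
  in \<open>odd_tail\<close> the argument \<open>N\<close> is the preceding summation variable (\<open>0\<close> for the first).
\<close>

definition odd_tail :: "nat \<Rightarrow> (nat \<Rightarrow> ennreal) \<Rightarrow> nat \<Rightarrow> ennreal" where
  "odd_tail e f N = (\<Sum>n. ennreal (1 / real (N + 2 * n + 1) ^ e) * f (N + 2 * n + 1))"

definition alt_sum :: "nat list \<Rightarrow> (nat \<Rightarrow> ennreal) \<Rightarrow> ennreal" where
  "alt_sum es f = foldr odd_tail es f 0"

lemma alt_sum_Nil [simp]: "alt_sum [] f = f 0"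
  by (simp add: alt_sum_def)

lemma alt_sum_snoc: "alt_sum (es @ [e]) f = alt_sum es (odd_tail e f)"
  by (simp add: alt_sum_def)

section \<open>Monotonicity and linearity of the nested sums\<close>

lemma odd_tail_mono:
  assumes "\<And>M. 0 < M \<Longrightarrow> f M \<le> g M"
  shows "odd_tail e f N \<le> odd_tail e g N"
  unfolding odd_tail_def by (intro suminf_le mult_left_mono assms) auto

lemma odd_tail_antimono_exponent:
  assumes "e \<le> e'"
  shows "odd_tail e' f N \<le> odd_tail e f N"
  unfolding odd_tail_def
  by (intro suminf_le mult_right_mono ennreal_leI divide_left_mono power_increasing assms) auto

lemma alt_sum_mono:
  assumes "\<And>M. f M \<le> g M"
  shows "alt_sum es f \<le> alt_sum es g"
  using assms
proof (induction es arbitrary: f g rule: rev_induct)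
  case (snoc e es)
  show ?case
    unfolding alt_sum_snoc by (intro snoc.IH odd_tail_mono snoc.prems)
qed auto

text \<open>The summation variables are at least 1, so raising an exponent can only shrink a term.
  Every convergence argument below compares exponents in this way.\<close>

lemma alt_sum_antimono_exponents:
  assumes "list_all2 (\<le>) es es'"
  shows "alt_sum es' f \<le> alt_sum es f"
  using assms
proof (induction es arbitrary: es' f rule: rev_induct)
  case (snoc e es)
  then obtain ds d where es': "es' = ds @ [d]" "list_all2 (\<le>) es ds" "e \<le> d"
    by (auto simp: list_all2_append1 list_all2_Cons1)
  have "alt_sum ds (odd_tail d f) \<le> alt_sum ds (odd_tail e f)"
    by (intro alt_sum_mono odd_tail_antimono_exponent es')
  also have "\<dots> \<le> alt_sum es (odd_tail e f)"
    by (rule snoc.IH[OF es'(2)])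
  finally show ?case
    by (simp add: es' alt_sum_snoc)
qed auto

text \<open>At least one exponent is present, so the weight is only evaluated at genuine summation
  variables, which are positive. This admits closed forms containing \<open>1 / M\<close>.\<close>

lemma alt_sum_snoc_cong:
  assumes "\<And>M. 0 < M \<Longrightarrow> f M = g M"
  shows "alt_sum (es @ [e]) f = alt_sum (es @ [e]) g"
proof -
  have "odd_tail e f = odd_tail e g"
    by (rule ext) (simp add: odd_tail_def assms)
  then show ?thesis
    by (simp add: alt_sum_snoc)
qed

text \<open>A power of \<open>1 / M\<close> produced by an integration is absorbed into the exponent
  of the largest variable.\<close>

lemma alt_sum_snoc_shift:
  "alt_sum (es @ [d]) (\<lambda>M. ennreal (1 / real M ^ e) * f M) = alt_sum (es @ [d + e]) f"
proof -
  have "odd_tail d (\<lambda>M. ennreal (1 / real M ^ e) * f M) = odd_tail (d + e) f"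
    by (rule ext) (simp add: odd_tail_def power_add ennreal_mult'[symmetric] mult.assoc[symmetric] divide_simps)
  then show ?thesis
    by (simp add: alt_sum_snoc)
qed

lemma alt_sum_cmult: "alt_sum es (\<lambda>M. c * f M) = c * alt_sum es f"
proof (induction es arbitrary: f rule: rev_induct)
  case (snoc e es)
  have "odd_tail e (\<lambda>M. c * f M) = (\<lambda>N. c * odd_tail e f N)"
    by (rule ext) (simp add: odd_tail_def mult.left_commute)
  then show ?case
    by (simp add: alt_sum_snoc snoc.IH)
qed simp

lemma alt_sum_sum: "alt_sum es (\<lambda>M. \<Sum>i\<in>I. f i M) = (\<Sum>i\<in>I. alt_sum es (f i))"
proof (induction es arbitrary: f rule: rev_induct)
  case (snoc e es)
  have "odd_tail e (\<lambda>M. \<Sum>i\<in>I. f i M) = (\<lambda>N. \<Sum>i\<in>I. odd_tail e (f i) N)"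
    by (rule ext) (simp add: odd_tail_def sum_distrib_left suminf_sum)
  then show ?case
    by (simp add: alt_sum_snoc snoc.IH)
qed simp

section \<open>Exchange of nested sums and integrals\<close>

lemma borel_measurable_odd_tail [measurable (raw)]:
  assumes "\<And>K. (\<lambda>x. f x K) \<in> borel_measurable M"
  shows "(\<lambda>x. odd_tail e (f x) N) \<in> borel_measurable M"
  unfolding odd_tail_def using assms by measurable

lemma borel_measurable_alt_sum [measurable (raw)]:
  assumes "\<And>K. (\<lambda>x. f x K) \<in> borel_measurable M"
  shows "(\<lambda>x. alt_sum es (f x)) \<in> borel_measurable M"
  using assms
  by (induction es arbitrary: f rule: rev_induct) (auto simp: alt_sum_snoc intro: borel_measurable_odd_tail)

lemma nn_integral_alt_sum:
  assumes "\<And>K. (\<lambda>x. f x K) \<in> borel_measurable M"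
  shows "(\<integral>\<^sup>+x. alt_sum es (f x) \<partial>M) = alt_sum es (\<lambda>K. \<integral>\<^sup>+x. f x K \<partial>M)"
  using assms
proof (induction es arbitrary: f rule: rev_induct)
  case (snoc e es)
  have "(\<integral>\<^sup>+x. odd_tail e (f x) N \<partial>M) = odd_tail e (\<lambda>K. \<integral>\<^sup>+x. f x K \<partial>M) N" for N
    unfolding odd_tail_def using snoc.prems
    by (subst nn_integral_suminf) (auto simp: nn_integral_cmult)
  then show ?case
    using snoc by (simp add: alt_sum_snoc borel_measurable_odd_tail)
qed simp

lemma set_nn_integral_mult_alt_sum:
  assumes "\<And>K. (\<lambda>x. f x K) \<in> borel_measurable M" and "c \<in> borel_measurable M" and "A \<in> sets M"
  shows "(\<integral>\<^sup>+x\<in>A. c x * alt_sum es (f x) \<partial>M) = alt_sum es (\<lambda>K. \<integral>\<^sup>+x\<in>A. c x * f x K \<partial>M)"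
proof -
  have "(\<integral>\<^sup>+x\<in>A. c x * alt_sum es (f x) \<partial>M) = (\<integral>\<^sup>+x. alt_sum es (\<lambda>K. c x * f x K * indicator A x) \<partial>M)"
    by (simp add: alt_sum_cmult[symmetric] mult.commute mult.left_commute)
  also have "\<dots> = alt_sum es (\<lambda>K. \<integral>\<^sup>+x\<in>A. c x * f x K \<partial>M)"
    using assms by (intro nn_integral_alt_sum) auto
  finally show ?thesis .
qed

text \<open>Consecutive variables have opposite parity, so they differ by an odd positive number.
  The prepended 0 plays the part of a preceding variable when \<open>ms\<close> is empty, and has
  the right parity for it.\<close>

lemma snoc_in_alt_seqs_iff:
  "ms @ [l] \<in> alt_seqs (Suc r) \<longleftrightarrow> ms \<in> alt_seqs r \<and> (\<exists>n. l = last (0 # ms) + 2 * n + 1)"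
proof -
  have last: "last (0 # ms) mod 2 = r mod 2" if "ms \<in> alt_seqs r"
    using that by (cases r) (auto simp: alt_seqs_def last_conv_nth)
  have lt: "last (0 # ms) < l" if "sorted_wrt (<) (ms @ [l])" "0 < l"
    using that by (cases ms rule: rev_cases) (auto simp: sorted_wrt_append)
  have sw: "sorted_wrt (<) (ms @ [l])" if "sorted_wrt (<) ms" "last (0 # ms) < l"
  proof (cases ms rule: rev_cases)
    case (snoc xs x)
    then have "y < l" if "y \<in> set ms" for y
      using that \<open>sorted_wrt (<) ms\<close> \<open>last (0 # ms) < l\<close>
      by (auto simp: sorted_wrt_append intro: less_trans)
    with that show ?thesis by (simp add: sorted_wrt_append)
  qed auto
  show ?thesis
  proof
    assume "ms @ [l] \<in> alt_seqs (Suc r)"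
    then have len: "length ms = r" and sorted: "sorted_wrt (<) (ms @ [l])"
      and nth: "\<And>i. i < Suc r \<Longrightarrow> 0 < (ms @ [l]) ! i \<and> (ms @ [l]) ! i mod 2 = Suc i mod 2"
      by (simp_all add: alt_seqs_def)
    have l: "0 < l" "l mod 2 = Suc r mod 2"
      using nth[of r] len by auto
    have "0 < ms ! i \<and> ms ! i mod 2 = Suc i mod 2" if "i < r" for i
      using nth[of i] that len by (simp add: nth_append)
    then have ms: "ms \<in> alt_seqs r"
      using len sorted by (simp add: alt_seqs_def sorted_wrt_append)
    have less: "last (0 # ms) < l"
      by (rule lt[OF sorted l(1)])
    have "odd (l - last (0 # ms))"
      using l(2) last[OF ms] less by (simp add: mod2_eq_if del: last.simps split: if_splits)
    then obtain n where "l - last (0 # ms) = 2 * n + 1" ..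
    with less have "l = last (0 # ms) + 2 * n + 1" by linarith
    with ms show "ms \<in> alt_seqs r \<and> (\<exists>n. l = last (0 # ms) + 2 * n + 1)" by blast
  next
    assume "ms \<in> alt_seqs r \<and> (\<exists>n. l = last (0 # ms) + 2 * n + 1)"
    then obtain n where ms: "ms \<in> alt_seqs r" and n: "l = last (0 # ms) + 2 * n + 1" by blast
    have less: "last (0 # ms) < l" using n by linarith
    have "l mod 2 = Suc r mod 2" using last[OF ms] by (simp add: n mod2_eq_if del: last.simps split: if_splits)
    moreover have "0 < l" using less by linarith
    ultimately show "ms @ [l] \<in> alt_seqs (Suc r)"
      using sw[OF _ less] ms by (simp add: alt_seqs_def nth_append less_Suc_eq)
  qed
qed

lemma alt_seqs_0 [simp]: "alt_seqs 0 = {[]}"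
  by (auto simp: alt_seqs_def)

lemma bij_betw_snoc_alt_seqs:
  "bij_betw (\<lambda>(ms, n). ms @ [last (0 # ms) + 2 * n + 1]) (alt_seqs r \<times> UNIV) (alt_seqs (Suc r))"
proof (rule bij_betw_imageI)
  show "inj_on (\<lambda>(ms, n). ms @ [last (0 # ms) + 2 * n + 1]) (alt_seqs r \<times> UNIV)"
    by (rule inj_onI) (auto simp del: last.simps)
  have "x \<in> (\<lambda>(ms, n). ms @ [last (0 # ms) + 2 * n + 1]) ` (alt_seqs r \<times> UNIV)"
    if x: "x \<in> alt_seqs (Suc r)" for x
  proof -
    have "x \<noteq> []" using x by (auto simp: alt_seqs_def)
    then obtain ms l where xm: "x = ms @ [l]" by (metis rev_exhaust)
    with x obtain n where "ms \<in> alt_seqs r" "l = last (0 # ms) + 2 * n + 1"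
      using snoc_in_alt_seqs_iff by blast
    then show ?thesis
      unfolding xm by (intro image_eqI[of _ _ "(ms, n)"]) simp_all
  qed
  moreover have "ms @ [last (0 # ms) + 2 * n + 1] \<in> alt_seqs (Suc r)" if "ms \<in> alt_seqs r" for ms n
    using that snoc_in_alt_seqs_iff by blast
  ultimately show "(\<lambda>(ms, n). ms @ [last (0 # ms) + 2 * n + 1]) ` (alt_seqs r \<times> UNIV) = alt_seqs (Suc r)"
    by (intro equalityI subsetI) (auto simp del: last.simps)
qed

lemma nn_integral_count_space_Times:
  fixes f :: "'a \<Rightarrow> 'b \<Rightarrow> ennreal"
  assumes "countable A" "countable B"
  shows "(\<integral>\<^sup>+p. f (fst p) (snd p) \<partial>count_space (A \<times> B))
       = (\<integral>\<^sup>+a. \<integral>\<^sup>+b. f a b \<partial>count_space B \<partial>count_space A)"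
proof -
  interpret B: sigma_finite_measure "count_space B"
    using assms(2) by (rule sigma_finite_measure_count_space_countable)
  have "count_space A \<Otimes>\<^sub>M count_space B = count_space (A \<times> B)"
    using assms by (rule pair_measure_countable)
  then show ?thesis
    using B.nn_integral_fst[of "\<lambda>p. f (fst p) (snd p)" "count_space A"] by simp
qed

text \<open>The induction peels off the largest variable. Summing over it turns \<open>f\<close>
  into \<open>odd_tail e f\<close>, which is the weight for the shorter sequence, hence the
  generalization over \<open>f\<close>.\<close>

lemma nn_integral_alt_seqs:
  "(\<integral>\<^sup>+ms. (\<Prod>i<length es. ennreal (1 / real (ms ! i) ^ (es ! i))) * f (last (0 # ms))
      \<partial>count_space (alt_seqs (length es))) = alt_sum es f"
proof (induction es arbitrary: f rule: rev_induct)
  case (snoc e es)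
  let ?r = "length es"
  let ?w = "\<lambda>es ms. \<Prod>i<length es. ennreal (1 / real (ms ! i) ^ (es ! i))"
  let ?g = "\<lambda>ms. ?w (es @ [e]) ms * f (last (0 # ms))"
  let ?\<phi> = "\<lambda>ms n. ms @ [last (0 # ms) + 2 * n + 1]"
  have g: "?g (?\<phi> ms n) = ?w es ms * (ennreal (1 / real (last (0 # ms) + 2 * n + 1) ^ e)
             * f (last (0 # ms) + 2 * n + 1))"
    if "ms \<in> alt_seqs ?r" for ms n
  proof -
    have "length ms = ?r" using that by (simp add: alt_seqs_def)
    then show ?thesis
      by (simp add: nth_append mult.assoc)
  qed
  have "(\<integral>\<^sup>+ms. ?g ms \<partial>count_space (alt_seqs (Suc ?r)))
      = (\<integral>\<^sup>+p. ?g (?\<phi> (fst p) (snd p)) \<partial>count_space (alt_seqs ?r \<times> UNIV))"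
    using nn_integral_bij_count_space[OF bij_betw_snoc_alt_seqs[of ?r], of ?g]
    by (simp add: case_prod_unfold)
  also have "\<dots> = (\<integral>\<^sup>+ms. \<integral>\<^sup>+n. ?g (?\<phi> ms n) \<partial>count_space UNIV \<partial>count_space (alt_seqs ?r))"
    by (rule nn_integral_count_space_Times) auto
  also have "\<dots> = (\<integral>\<^sup>+ms. ?w es ms * odd_tail e f (last (0 # ms)) \<partial>count_space (alt_seqs ?r))"
    by (intro nn_integral_cong)
      (simp only: g space_count_space nn_integral_count_space_nat odd_tail_def ennreal_suminf_cmult)
  also have "\<dots> = alt_sum (es @ [e]) f"
    by (simp only: snoc.IH alt_sum_snoc)
  finally show ?case by simp
qed (simp add: nn_integral_count_space_finite)

text \<open>The equation covers divergent sums as well: \<open>infsum\<close> is then 0 by default,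
  and so is \<open>enn2real\<close> of infinity.\<close>

lemma infsum_eq_enn2real_nn_integral:
  assumes "\<And>x. x \<in> A \<Longrightarrow> 0 \<le> f x"
  shows "infsum f A = enn2real (\<integral>\<^sup>+x. ennreal (f x) \<partial>count_space A)"
proof -
  have "infsum f A = infsetsum f A"
  proof (cases "Infinite_Set_Sum.abs_summable_on f A")
    case True
    then show ?thesis by (simp add: infsetsum_infsum)
  next
    case False
    then have "\<not> f summable_on A"
      using summable_on_iff_abs_summable_on_real[of f A] by (simp add: abs_summable_equivalent[symmetric])
    then show ?thesis
      by (simp add: infsum_not_exists not_summable_infsetsum_eq False)
  qed
  also have "\<dots> = enn2real (\<integral>\<^sup>+x. ennreal (f x) \<partial>count_space A)"
    unfolding infsetsum_def using assms by (intro integral_eq_nn_integral) (auto simp: AE_count_space)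
  finally show ?thesis .
qed

subsection \<open>Compositions\<close>

abbreviation (input) comps :: "nat \<Rightarrow> nat \<Rightarrow> nat list set" where
  "comps q d \<equiv> {a. length a = q \<and> sum_list a = d}"

lemma finite_comps [simp]: "finite (comps q d)"
proof (rule finite_subset)
  show "comps q d \<subseteq> {a. set a \<subseteq> {..d} \<and> length a = q}"
    by (auto intro: member_le_sum_list)
qed (simp add: finite_lists_length_eq)

lemma comps_0: "comps 0 d = (if d = 0 then {[]} else {})"
  by auto

text \<open>The last entry is split off because each integration appends the new exponent at the end
  of the list.\<close>

lemma sum_comps_Suc:
  fixes F :: "nat list \<Rightarrow> 'a::comm_monoid_add"
  shows "(\<Sum>a\<in>comps (Suc q) d. F a) = (\<Sum>i\<le>d. \<Sum>c\<in>comps q (d - i). F (c @ [i]))"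
proof -
  have "(\<Sum>a\<in>comps (Suc q) d. F a) = (\<Sum>(i, c)\<in>(SIGMA i:{..d}. comps q (d - i)). F (c @ [i]))"
  proof (rule sum.reindex_bij_witness[where j = "\<lambda>a. (last a, butlast a)" and i = "\<lambda>(i, c). c @ [i]"])
    fix a assume "a \<in> comps (Suc q) d"
    moreover from this have "a \<noteq> []" by auto
    ultimately have "sum_list (butlast a @ [last a]) = d" "length (butlast a) = q" by auto
    then show "(last a, butlast a) \<in> (SIGMA i:{..d}. comps q (d - i))"
      by (simp only: sum_list_append) auto
    show "(case (last a, butlast a) of (i, c) \<Rightarrow> c @ [i]) = a"
      "(case (last a, butlast a) of (i, c) \<Rightarrow> F (c @ [i])) = F a"
      using \<open>a \<noteq> []\<close> by simp_all
  qed auto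
  also have "\<dots> = (\<Sum>i\<le>d. \<Sum>c\<in>comps q (d - i). F (c @ [i]))"
    by (subst sum.Sigma) auto
  finally show ?thesis .
qed

subsection \<open>Hyperbolic expansions and elementary integrals\<close>

text \<open>A geometric series of ratio \<open>exp (- 2 * t)\<close>, the expansion of
  \<open>1 / sinh t\<close> over odd exponents shifted by \<open>N\<close>.\<close>

lemma odd_tail_exp:
  assumes "0 < t"
  shows "odd_tail 0 (\<lambda>M. ennreal (exp (- real M * t))) N = ennreal (exp (- real N * t) / (2 * sinh t))"
proof -
  let ?q = "exp (- (2 * t))"
  have q: "0 \<le> ?q" "?q < 1" using assms by auto
  have "(\<lambda>n. exp (- (real N + 1) * t) * ?q ^ n) sums (exp (- (real N + 1) * t) * (1 / (1 - ?q)))"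
    using q by (intro sums_mult geometric_sums) auto
  also have "(\<lambda>n. exp (- (real N + 1) * t) * ?q ^ n) = (\<lambda>n. exp (- real (N + 2 * n + 1) * t))"
    by (rule ext) (simp add: exp_of_nat_mult[symmetric] exp_add[symmetric] algebra_simps)
  also have "exp (- (real N + 1) * t) * (1 / (1 - ?q)) = exp (- real N * t) / (2 * sinh t)"
  proof -
    have "2 * sinh t = exp t * (1 - ?q)"
      by (simp add: sinh_field_def right_diff_distrib exp_add[symmetric])
    moreover have "exp (- (real N + 1) * t) = exp (- real N * t) / exp t"
      by (simp add: exp_diff[symmetric] algebra_simps)
    ultimately show ?thesis by simp
  qed
  finally show ?thesis
    unfolding odd_tail_def using assms
    by (subst suminf_ennreal_eq[symmetric, where f = "\<lambda>n. exp (- real (N + 2 * n + 1) * t)"]) auto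
qed

lemma sinh_eq_tanh_half: "sinh t * (1 - (tanh (t / 2))\<^sup>2) = 2 * tanh (t / 2)" for t :: real
proof -
  have "(1 - (tanh (t / 2))\<^sup>2) * (cosh (t / 2))\<^sup>2 = 1"
    using hyperbolic_pythagoras[of "t / 2"] by (simp add: tanh_def power_divide left_diff_distrib)
  moreover have "sinh t = 2 * tanh (t / 2) * (cosh (t / 2))\<^sup>2"
    using sinh_double[of "t / 2"] by (simp add: tanh_def power2_eq_square)
  ultimately show ?thesis by (simp add: mult_ac)
qed

text \<open>With \<open>z = tanh (t / 2)\<close> this is a geometric series in
  \<open>z\<^sup>2\<close>, evaluated through
  \<open>z / (1 - z\<^sup>2) = sinh t / 2\<close>.\<close>

lemma sums_tanh_odd:
  assumes "0 < (t::real)"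
  shows "(\<lambda>n. tanh (t / 2) ^ (N + 2 * n + 1)) sums (tanh (t / 2) ^ N * (sinh t / 2))"
proof -
  let ?z = "tanh (t / 2)"
  have z: "0 < ?z" "?z < 1" using assms by (auto simp: tanh_real_lt_1)
  then have "?z\<^sup>2 < 1" by (simp add: power_less_one_iff)
  then have "(\<lambda>n. ?z ^ Suc N * (?z\<^sup>2) ^ n) sums (?z ^ Suc N * (1 / (1 - ?z\<^sup>2)))"
    by (intro sums_mult geometric_sums) auto
  also have "(\<lambda>n. ?z ^ Suc N * (?z\<^sup>2) ^ n) = (\<lambda>n. ?z ^ (N + 2 * n + 1))"
    by (rule ext) (simp add: power_mult[symmetric] power_add)
  also have "?z ^ Suc N * (1 / (1 - ?z\<^sup>2)) = ?z ^ N * (?z / (1 - ?z\<^sup>2))"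
    by simp
  also have "?z / (1 - ?z\<^sup>2) = sinh t / 2"
    using sinh_eq_tanh_half[of t] \<open>?z\<^sup>2 < 1\<close> by (simp add: field_simps)
  finally show ?thesis .
qed

lemma DERIV_tanh_half_power:
  assumes "0 < M"
  shows "((\<lambda>s::real. tanh (s / 2) ^ M / real M) has_real_derivative
           tanh (s / 2) ^ (M - 1) * (1 - (tanh (s / 2))\<^sup>2) / 2) (at s)"
  using assms by (auto intro!: derivative_eq_intros simp: field_simps)

text \<open>Since \<open>ds / sinh s = dz / z\<close> for \<open>z = tanh (s / 2)\<close>, this is
  the integral of \<open>z ^ (M - 1)\<close> in disguise.\<close>

lemma nn_integral_tanh_power:
  assumes "0 < M" "0 \<le> (t::real)"
  shows "(\<integral>\<^sup>+s\<in>{0<..<t}. ennreal (1 / sinh s) * ennreal (tanh (s / 2) ^ M) \<partial>lborel)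
       = ennreal (1 / real M) * ennreal (tanh (t / 2) ^ M)"
proof -
  let ?f = "\<lambda>s::real. tanh (s / 2) ^ (M - 1) * (1 - (tanh (s / 2))\<^sup>2) / 2"
  have eq: "tanh (s / 2) ^ M / sinh s = ?f s" if "0 < s" for s :: real
  proof -
    have z: "0 < tanh (s / 2)" "sinh s > 0" using that by auto
    have "tanh (s / 2) ^ M = tanh (s / 2) ^ (M - 1) * (sinh s * (1 - (tanh (s / 2))\<^sup>2) / 2)"
      using power_minus_mult[OF assms(1), of "tanh (s / 2)"] by (simp add: sinh_eq_tanh_half)
    with z show ?thesis by (simp add: field_simps)
  qed
  have "(\<integral>\<^sup>+s\<in>{0<..<t}. ennreal (1 / sinh s) * ennreal (tanh (s / 2) ^ M) \<partial>lborel)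
      = (\<integral>\<^sup>+s\<in>{0..t}. ennreal (?f s) \<partial>lborel)"
  \<comment> \<open>The fundamental theorem is applied on the closed interval. The two integrands
    may disagree at the endpoints, for instance at 0 when \<open>M = 1\<close>, but these form a
    null set.\<close>
  proof (rule nn_integral_cong_AE)
    have "AE s in lborel. s \<noteq> 0 \<and> s \<noteq> t"
      using AE_lborel_singleton[of 0] AE_lborel_singleton[of t] by eventually_elim simp
    then show "AE s in lborel. ennreal (1 / sinh s) * ennreal (tanh (s / 2) ^ M) * indicator {0<..<t} s
        = ennreal (?f s) * indicator {0..t} s"
    proof eventually_elim
      case (elim s)
      show ?case
      proof (cases "s \<in> {0<..<t}")
        case True
        then show ?thesis
          by (subst eq[symmetric]) (auto simp: ennreal_mult'[symmetric])
      qed (use elim in auto)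
    qed
  qed
  also have "\<dots> = ennreal (tanh (t / 2) ^ M / real M - tanh (0 / 2) ^ M / real M)"
  proof (rule nn_integral_FTC_Icc[where F = "\<lambda>s. tanh (s / 2) ^ M / real M"])
    show "?f \<in> borel_measurable borel"
      by (intro borel_measurable_continuous_onI continuous_intros) auto
    show "((\<lambda>s. tanh (s / 2) ^ M / real M) has_real_derivative ?f s) (at s)" for s
      by (rule DERIV_tanh_half_power[OF assms(1)])
    show "0 \<le> ?f s" if "s \<in> {0..t}" for s
      using that tanh_real_lt_1[of "s / 2"] by (simp add: power_le_one)
  qed (use assms in auto)
  also have "\<dots> = ennreal (1 / real M) * ennreal (tanh (t / 2) ^ M)"
    using assms by (simp add: ennreal_mult'[symmetric] zero_power)
  finally show ?thesis .
qed

text \<open>For \<open>M > 0\<close> this is the integral of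
  \<open>x ^ b / fact b * exp (- M * x)\<close> over \<open>x > t\<close>, as computed by repeated
  integration by parts.\<close>

definition exp_power_primitive :: "nat \<Rightarrow> real \<Rightarrow> real \<Rightarrow> real" where
  "exp_power_primitive b M t = (\<Sum>j\<le>b. t ^ j / fact j * exp (- M * t) / M ^ Suc (b - j))"

lemma exp_power_primitive_Suc:
  assumes "M \<noteq> 0"
  shows "exp_power_primitive (Suc b) M t =
    exp_power_primitive b M t / M + t ^ Suc b / fact (Suc b) * exp (- M * t) / M"
proof -
  have "(\<Sum>j\<le>b. t ^ j / fact j * exp (- M * t) / M ^ Suc (Suc b - j)) = exp_power_primitive b M t / M"
    unfolding exp_power_primitive_def sum_divide_distrib
    by (intro sum.cong) (auto simp: Suc_diff_le)
  then show ?thesis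
    by (simp add: exp_power_primitive_def[of "Suc b"])
qed

lemma DERIV_exp_power_primitive:
  assumes "M \<noteq> 0"
  shows "((\<lambda>t. - exp_power_primitive b M t) has_real_derivative t ^ b / fact b * exp (- M * t)) (at t)"
proof (induction b)
  case 0
  then show ?case
    using assms by (auto simp: exp_power_primitive_def intro!: derivative_eq_intros)
next
  case (Suc b)
  have *: "((\<lambda>t. t ^ Suc b / fact (Suc b) * exp (- M * t)) has_real_derivative
      t ^ b / fact b * exp (- M * t) - M * (t ^ Suc b / fact (Suc b) * exp (- M * t))) (at t)"
    by (rule derivative_eq_intros refl | simp add: field_simps del: of_nat_Suc)+
  \<comment> \<open>The contribution of the induction hypothesis cancels against the first part of
    the product rule, leaving only the term with \<open>t ^ Suc b\<close>.\<close>
  have "((\<lambda>t. (- exp_power_primitive b M t) / M - t ^ Suc b / fact (Suc b) * exp (- M * t) / M)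
      has_real_derivative (t ^ b / fact b * exp (- M * t)) / M
        - (t ^ b / fact b * exp (- M * t) - M * (t ^ Suc b / fact (Suc b) * exp (- M * t))) / M) (at t)"
    by (intro DERIV_diff DERIV_cdivide Suc.IH *)
  also have "(\<lambda>t. (- exp_power_primitive b M t) / M - t ^ Suc b / fact (Suc b) * exp (- M * t) / M)
      = (\<lambda>t. - exp_power_primitive (Suc b) M t)"
    by (rule ext) (simp add: exp_power_primitive_Suc[OF assms] del: power_Suc fact_Suc)
  finally show ?case
    using assms by (simp add: diff_divide_distrib)
qed

lemma exp_power_primitive_tendsto_0:
  assumes "0 < M"
  shows "((\<lambda>t. - exp_power_primitive b M t) \<longlongrightarrow> 0) at_top"
proof -
  have "((\<lambda>t. t ^ j / fact j * exp (- M * t) / M ^ Suc (b - j)) \<longlongrightarrow> 0) at_top" for j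
  proof -
    \<comment> \<open>The known limit of \<open>u ^ j / exp u\<close> is used with
      \<open>u = M * t\<close>.\<close>
    have "((\<lambda>t. (M * t) ^ j / exp (M * t)) \<longlongrightarrow> 0) at_top"
      using filterlim_compose[OF tendsto_power_div_exp_0[of j]
          filterlim_tendsto_pos_mult_at_top[OF tendsto_const assms filterlim_ident]] .
    then have "((\<lambda>t. (M * t) ^ j / exp (M * t) / (M ^ j * fact j * M ^ Suc (b - j))) \<longlongrightarrow> 0) at_top"
      by (rule tendsto_divide_zero)
    then show ?thesis
      using assms by (simp add: power_mult_distrib exp_minus field_simps)
  qed
  then have "((\<lambda>t. - exp_power_primitive b M t) \<longlongrightarrow> - (\<Sum>j\<le>b. 0)) at_top"
    unfolding exp_power_primitive_def by (intro tendsto_intros)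
  then show ?thesis by simp
qed

text \<open>The primitive vanishes at infinity. In the term of index \<open>j\<close>, the power
  \<open>b\<close> has been split into \<open>s ^ j\<close>, left for later integrations, and the
  exponent \<open>b - j + 1\<close> of \<open>M\<close>.\<close>

lemma nn_integral_power_exp:
  assumes "0 < M" "0 \<le> s"
  shows "(\<integral>\<^sup>+t\<in>{s<..}. ennreal (t ^ b / fact b) * ennreal (exp (- real M * t)) \<partial>lborel)
       = (\<Sum>j\<le>b. ennreal (s ^ j / fact j) * (ennreal (1 / real M ^ Suc (b - j)) * ennreal (exp (- real M * s))))"
proof -
  let ?f = "\<lambda>t. t ^ b / fact b * exp (- real M * t)"
  have "(\<integral>\<^sup>+t\<in>{s<..}. ennreal (t ^ b / fact b) * ennreal (exp (- real M * t)) \<partial>lborel)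
      = (\<integral>\<^sup>+t\<in>{s..}. ennreal (?f t) \<partial>lborel)"
  proof (rule nn_integral_cong_AE)
    show "AE t in lborel. ennreal (t ^ b / fact b) * ennreal (exp (- real M * t)) * indicator {s<..} t
        = ennreal (?f t) * indicator {s..} t"
      using AE_lborel_singleton[of s]
      by eventually_elim (use assms in \<open>auto simp: ennreal_mult'[symmetric] split: split_indicator\<close>)
  qed
  also have "\<dots> = ennreal (0 - (- exp_power_primitive b (real M) s))"
    using assms
    by (intro nn_integral_FTC_atLeast DERIV_exp_power_primitive exp_power_primitive_tendsto_0) auto
  also have "\<dots> = ennreal (exp_power_primitive b (real M) s)" by simp
  also have "\<dots> = (\<Sum>j\<le>b. ennreal (s ^ j / fact j * exp (- real M * s) / real M ^ Suc (b - j)))"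
    unfolding exp_power_primitive_def using assms by (subst sum_ennreal) auto
  also have "\<dots> = (\<Sum>j\<le>b. ennreal (s ^ j / fact j) * (ennreal (1 / real M ^ Suc (b - j)) * ennreal (exp (- real M * s))))"
    using assms by (intro sum.cong refl) (simp add: ennreal_mult'[symmetric] ennreal_mult''[symmetric])
  finally show ?thesis .
qed

subsection \<open>Iterated integrals\<close>

lemma nn_integral_double_sum:
  assumes "\<And>i j. f i j \<in> borel_measurable M"
  shows "(\<integral>\<^sup>+x. (\<Sum>i\<in>I. \<Sum>j\<in>J i. c i j * f i j x) \<partial>M) = (\<Sum>i\<in>I. \<Sum>j\<in>J i. c i j * (\<integral>\<^sup>+x. f i j x \<partial>M))"
  using assms by (simp add: nn_integral_sum nn_integral_cmult)

lemma borel_measurable_tanh [measurable]: "(tanh :: real \<Rightarrow> real) \<in> borel_measurable borel"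
  by (intro borel_measurable_continuous_onI continuous_intros) auto

lemma borel_measurable_sinh [measurable]: "(sinh :: real \<Rightarrow> real) \<in> borel_measurable borel"
  by (intro borel_measurable_continuous_onI continuous_intros)

text \<open>
  \<open>P\<^sub>q(t)\<close>, the result of \<open>q\<close> integrations \<open>P \<mapsto> \<integral>\<^sub>s\<^sup>\<infinity> P(t) dt / sinh t\<close> starting from \<open>t\<^sup>m / m!\<close>.
\<close>

definition tail_integral :: "nat \<Rightarrow> nat \<Rightarrow> real \<Rightarrow> ennreal" where
  "tail_integral m q t = (\<Sum>b\<le>m. ennreal (t ^ b / fact b) *
     (2 ^ q * (\<Sum>c\<in>comps q (m - b). alt_sum (map Suc c) (\<lambda>M. ennreal (exp (- real M * t))))))"

lemma borel_measurable_tail_integral [measurable]: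
  "tail_integral m q \<in> borel_measurable borel"
  unfolding tail_integral_def by measurable

lemma tail_integral_0: "tail_integral m 0 t = ennreal (t ^ m / fact m)"
proof -
  have "tail_integral m 0 t = (\<Sum>b\<le>m. if b = m then ennreal (t ^ b / fact b) else 0)"
    unfolding tail_integral_def comps_0 by (intro sum.cong) auto
  then show ?thesis by simp
qed

text \<open>Expanding \<open>1 / sinh t\<close> lengthens the sequence by one variable. Its exponent
  is still 0; the integration over \<open>t\<close> will raise it.\<close>

lemma alt_sum_exp_div_sinh:
  assumes "0 < t"
  shows "ennreal (1 / sinh t) * alt_sum es (\<lambda>M. ennreal (exp (- real M * t)))
       = 2 * alt_sum (es @ [0]) (\<lambda>M. ennreal (exp (- real M * t)))"
proof -
  have "odd_tail 0 (\<lambda>M. ennreal (exp (- real M * t)))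
      = (\<lambda>N. ennreal (1 / (2 * sinh t)) * ennreal (exp (- real N * t)))"
    by (rule ext, subst odd_tail_exp[OF assms]) (use assms in \<open>simp add: ennreal_mult''[symmetric]\<close>)
  then have "2 * alt_sum (es @ [0]) (\<lambda>M. ennreal (exp (- real M * t)))
      = ennreal 2 * ennreal (1 / (2 * sinh t)) * alt_sum es (\<lambda>M. ennreal (exp (- real M * t)))"
    by (simp only: alt_sum_snoc alt_sum_cmult mult.assoc ennreal_numeral[symmetric])
  also have "ennreal 2 * ennreal (1 / (2 * sinh t)) = ennreal (1 / sinh t)"
    using assms by (subst ennreal_mult''[symmetric]) auto
  finally show ?thesis ..
qed

lemma nn_integral_power_alt_sum:
  assumes "0 \<le> s"
  shows "(\<integral>\<^sup>+t\<in>{s<..}. ennreal (t ^ b / fact b) *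
            alt_sum es (\<lambda>M. ennreal (exp (- real M * t))) * ennreal (1 / sinh t) \<partial>lborel)
       = (\<Sum>j\<le>b. ennreal (s ^ j / fact j) *
            (2 * alt_sum (es @ [Suc (b - j)]) (\<lambda>M. ennreal (exp (- real M * s)))))"
proof -
  have "(\<integral>\<^sup>+t\<in>{s<..}. ennreal (t ^ b / fact b) *
            alt_sum es (\<lambda>M. ennreal (exp (- real M * t))) * ennreal (1 / sinh t) \<partial>lborel)
      = (\<integral>\<^sup>+t. 2 * (ennreal (t ^ b / fact b) *
            alt_sum (es @ [0]) (\<lambda>M. ennreal (exp (- real M * t))) * indicator {s<..} t) \<partial>lborel)"
  proof (intro nn_integral_cong)
    fix t
    show "ennreal (t ^ b / fact b) * alt_sum es (\<lambda>M. ennreal (exp (- real M * t))) *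
        ennreal (1 / sinh t) * indicator {s<..} t
      = 2 * (ennreal (t ^ b / fact b) *
        alt_sum (es @ [0]) (\<lambda>M. ennreal (exp (- real M * t))) * indicator {s<..} t)"
    proof (cases "s < t")
      case True
      then show ?thesis
        using arg_cong[OF alt_sum_exp_div_sinh[of t es], of "(*) (ennreal (t ^ b / fact b))"] assms
        by (simp add: ac_simps)
    qed simp
  qed
  also have "\<dots> = 2 * (\<integral>\<^sup>+t\<in>{s<..}. ennreal (t ^ b / fact b) *
            alt_sum (es @ [0]) (\<lambda>M. ennreal (exp (- real M * t))) \<partial>lborel)"
    by (rule nn_integral_cmult) measurable
  also have "(\<integral>\<^sup>+t\<in>{s<..}. ennreal (t ^ b / fact b) *
            alt_sum (es @ [0]) (\<lambda>M. ennreal (exp (- real M * t))) \<partial>lborel)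
      = alt_sum (es @ [0]) (\<lambda>M. \<integral>\<^sup>+t\<in>{s<..}. ennreal (t ^ b / fact b) * ennreal (exp (- real M * t)) \<partial>lborel)"
    by (rule set_nn_integral_mult_alt_sum) measurable
  also have "\<dots> = alt_sum (es @ [0]) (\<lambda>M. \<Sum>j\<le>b. ennreal (s ^ j / fact j) *
      (ennreal (1 / real M ^ Suc (b - j)) * ennreal (exp (- real M * s))))"
    by (intro alt_sum_snoc_cong nn_integral_power_exp assms)
  \<comment> \<open>Here the provisional exponent 0 of the new variable becomes
    \<open>b - j + 1\<close>.\<close>
  also have "\<dots> = (\<Sum>j\<le>b. ennreal (s ^ j / fact j) *
      alt_sum (es @ [Suc (b - j)]) (\<lambda>M. ennreal (exp (- real M * s))))"
    by (simp only: alt_sum_sum alt_sum_cmult alt_sum_snoc_shift add_0)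
  also have "2 * \<dots> = (\<Sum>j\<le>b. ennreal (s ^ j / fact j) *
            (2 * alt_sum (es @ [Suc (b - j)]) (\<lambda>M. ennreal (exp (- real M * s)))))"
    by (simp add: sum_distrib_left mult.left_commute)
  finally show ?thesis .
qed

text \<open>Reorders the double sum so that the remaining power \<open>j\<close> comes first and the
  part \<open>i = b - j\<close> passed to the new exponent second.\<close>

lemma sum_triangle_diagonal:
  fixes g :: "nat \<Rightarrow> nat \<Rightarrow> 'a::comm_monoid_add"
  shows "(\<Sum>b\<le>m. \<Sum>j\<le>b. g j (b - j)) = (\<Sum>j\<le>m. \<Sum>i\<le>m - j. g j i)"
  unfolding sum.Sigma[OF finite_atMost ballI[OF finite_atMost]]
  by (rule sum.reindex_bij_witness[where j = "\<lambda>(b, j). (j, b - j)" and i = "\<lambda>(j, i). (j + i, j)"]) auto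

lemma nn_integral_tail_integral:
  assumes "0 \<le> s"
  shows "(\<integral>\<^sup>+t\<in>{s<..}. tail_integral m q t * ennreal (1 / sinh t) \<partial>lborel) = tail_integral m (Suc q) s"
proof -
  let ?E = "\<lambda>es t. alt_sum es (\<lambda>M. ennreal (exp (- real M * t)))"
  have "(\<integral>\<^sup>+t\<in>{s<..}. tail_integral m q t * ennreal (1 / sinh t) \<partial>lborel)
      = (\<integral>\<^sup>+t. (\<Sum>b\<le>m. \<Sum>c\<in>comps q (m - b). 2 ^ q *
          (ennreal (t ^ b / fact b) * ?E (map Suc c) t * ennreal (1 / sinh t) * indicator {s<..} t)) \<partial>lborel)"
    unfolding tail_integral_def by (simp add: sum_distrib_left sum_distrib_right ac_simps)
  also have "\<dots> = (\<Sum>b\<le>m. \<Sum>c\<in>comps q (m - b). 2 ^ q *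
      (\<integral>\<^sup>+t\<in>{s<..}. ennreal (t ^ b / fact b) * ?E (map Suc c) t * ennreal (1 / sinh t) \<partial>lborel))"
    by (rule nn_integral_double_sum) measurable
  \<comment> \<open>Writing \<open>m - b\<close> as \<open>m - j - (b - j)\<close> makes the summand
    a function of \<open>j\<close> and \<open>b - j\<close> alone, as the reordering
    requires.\<close>
  also have "\<dots> = (\<Sum>b\<le>m. \<Sum>j\<le>b. \<Sum>c\<in>comps q (m - j - (b - j)).
      ennreal (s ^ j / fact j) * (2 ^ Suc q * ?E (map Suc (c @ [b - j])) s))"
  proof (intro sum.cong refl)
    fix b
    have "(\<Sum>c\<in>comps q (m - b). 2 ^ q *
        (\<integral>\<^sup>+t\<in>{s<..}. ennreal (t ^ b / fact b) * ?E (map Suc c) t * ennreal (1 / sinh t) \<partial>lborel))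
      = (\<Sum>c\<in>comps q (m - b). \<Sum>j\<le>b. ennreal (s ^ j / fact j) * (2 ^ Suc q * ?E (map Suc (c @ [b - j])) s))"
      unfolding nn_integral_power_alt_sum[OF assms] by (simp add: sum_distrib_left ac_simps)
    also have "\<dots> = (\<Sum>j\<le>b. \<Sum>c\<in>comps q (m - b). ennreal (s ^ j / fact j) * (2 ^ Suc q * ?E (map Suc (c @ [b - j])) s))"
      by (rule sum.swap)
    also have "\<dots> = (\<Sum>j\<le>b. \<Sum>c\<in>comps q (m - j - (b - j)).
        ennreal (s ^ j / fact j) * (2 ^ Suc q * ?E (map Suc (c @ [b - j])) s))"
      by (intro sum.cong[OF refl]) simp
    finally show "(\<Sum>c\<in>comps q (m - b). 2 ^ q *
        (\<integral>\<^sup>+t\<in>{s<..}. ennreal (t ^ b / fact b) * ?E (map Suc c) t * ennreal (1 / sinh t) \<partial>lborel))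
      = (\<Sum>j\<le>b. \<Sum>c\<in>comps q (m - j - (b - j)).
        ennreal (s ^ j / fact j) * (2 ^ Suc q * ?E (map Suc (c @ [b - j])) s))" .
  qed
  also have "\<dots> = (\<Sum>j\<le>m. \<Sum>i\<le>m - j. \<Sum>c\<in>comps q (m - j - i).
      ennreal (s ^ j / fact j) * (2 ^ Suc q * ?E (map Suc (c @ [i])) s))"
    by (rule sum_triangle_diagonal)
  also have "\<dots> = tail_integral m (Suc q) s"
    unfolding tail_integral_def sum_comps_Suc by (simp only: sum_distrib_left)
  finally show ?thesis .
qed

text \<open>\<open>Ath_ones r q t\<close> is \<open>Ath(1, \<dots>, 1, q + 1; tanh (t / 2))\<close> with \<open>r\<close> leading ones.\<close>

definition Ath_ones :: "nat \<Rightarrow> nat \<Rightarrow> real \<Rightarrow> ennreal" where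
  "Ath_ones r q t = alt_sum (replicate r 1 @ [Suc q]) (\<lambda>M. ennreal (tanh (t / 2) ^ M))"

lemma borel_measurable_Ath_ones [measurable]: "Ath_ones r q \<in> borel_measurable borel"
  unfolding Ath_ones_def by measurable

text \<open>Termwise integration against \<open>ds / sinh s\<close> gives a factor
  \<open>1 / M\<close>, which raises the last exponent by one.\<close>

lemma nn_integral_Ath_ones:
  assumes "0 \<le> t"
  shows "(\<integral>\<^sup>+s\<in>{0<..<t}. ennreal (1 / sinh s) * Ath_ones r q s \<partial>lborel) = Ath_ones r (Suc q) t"
proof -
  have "(\<integral>\<^sup>+s\<in>{0<..<t}. ennreal (1 / sinh s) * Ath_ones r q s \<partial>lborel)
      = alt_sum (replicate r 1 @ [Suc q])
          (\<lambda>M. \<integral>\<^sup>+s\<in>{0<..<t}. ennreal (1 / sinh s) * ennreal (tanh (s / 2) ^ M) \<partial>lborel)"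
    unfolding Ath_ones_def by (rule set_nn_integral_mult_alt_sum) measurable
  also have "\<dots> = alt_sum (replicate r 1 @ [Suc q])
      (\<lambda>M. ennreal (1 / real M ^ 1) * ennreal (tanh (t / 2) ^ M))"
    unfolding power_one_right by (intro alt_sum_snoc_cong nn_integral_tanh_power assms)
  also have "\<dots> = Ath_ones r (Suc q) t"
    unfolding alt_sum_snoc_shift Ath_ones_def by simp
  finally show ?thesis .
qed

text \<open>Each term \<open>z ^ M / M\<close> is an integral against \<open>ds / sinh s\<close>.
  Summing the geometric series under the integral cancels \<open>sinh s\<close>, so a variable of
  exponent 1 amounts to one integration against \<open>ds / 2\<close>.\<close>

lemma odd_tail_tanh:
  assumes "0 \<le> t"
  shows "odd_tail 1 (\<lambda>M. ennreal (tanh (t / 2) ^ M)) N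
       = (\<integral>\<^sup>+s\<in>{0<..<t}. ennreal (1 / 2) * ennreal (tanh (s / 2) ^ N) \<partial>lborel)"
proof -
  let ?f = "\<lambda>n s. ennreal (1 / sinh s) * ennreal (tanh (s / 2) ^ (N + 2 * n + 1)) * indicator {0<..<t} s"
  have "odd_tail 1 (\<lambda>M. ennreal (tanh (t / 2) ^ M)) N = (\<Sum>n. \<integral>\<^sup>+s. ?f n s \<partial>lborel)"
    unfolding odd_tail_def using assms by (subst nn_integral_tanh_power) auto
  also have "\<dots> = (\<integral>\<^sup>+s. (\<Sum>n. ?f n s) \<partial>lborel)"
    by (rule nn_integral_suminf[symmetric]) measurable
  also have "\<dots> = (\<integral>\<^sup>+s\<in>{0<..<t}. ennreal (1 / 2) * ennreal (tanh (s / 2) ^ N) \<partial>lborel)"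
  proof (intro nn_integral_cong)
    fix s :: real
    show "(\<Sum>n. ?f n s) = ennreal (1 / 2) * ennreal (tanh (s / 2) ^ N) * indicator {0<..<t} s"
    proof (cases "s \<in> {0<..<t}")
      case True
      then have s: "0 < s" by simp
      have "(\<Sum>n. ?f n s) = ennreal (1 / sinh s) * (\<Sum>n. ennreal (tanh (s / 2) ^ (N + 2 * n + 1)))"
        using True by simp
      also have "(\<Sum>n. ennreal (tanh (s / 2) ^ (N + 2 * n + 1))) = ennreal (tanh (s / 2) ^ N * (sinh s / 2))"
        using s by (intro suminf_ennreal_eq sums_tanh_odd) auto
      also have "ennreal (1 / sinh s) * \<dots> = ennreal (1 / 2) * ennreal (tanh (s / 2) ^ N)"
        using s by (subst (1 2) ennreal_mult''[symmetric]) (auto simp: field_simps)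
      finally show ?thesis using True by simp
    qed simp
  qed
  finally show ?thesis .
qed

lemma nn_integral_power_half:
  assumes "0 \<le> (t::real)"
  shows "(\<integral>\<^sup>+s\<in>{0<..<t}. ennreal (1 / 2) * ennreal ((s / 2) ^ r / fact r) \<partial>lborel)
       = ennreal ((t / 2) ^ Suc r / fact (Suc r))"
proof -
  have "(\<integral>\<^sup>+s\<in>{0<..<t}. ennreal (1 / 2) * ennreal ((s / 2) ^ r / fact r) \<partial>lborel)
      = (\<integral>\<^sup>+s\<in>{0..t}. ennreal (1 / 2 * ((s / 2) ^ r / fact r)) \<partial>lborel)"
  proof (rule nn_integral_cong_AE)
    have "AE s in lborel. s \<noteq> 0 \<and> s \<noteq> t"
      using AE_lborel_singleton[of 0] AE_lborel_singleton[of t] by eventually_elim simp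
    then show "AE s in lborel. ennreal (1 / 2) * ennreal ((s / 2) ^ r / fact r) * indicator {0<..<t} s
        = ennreal (1 / 2 * ((s / 2) ^ r / fact r)) * indicator {0..t} s"
    proof eventually_elim
      case (elim s)
      show ?case
      proof (cases "0 < s \<and> s < t")
        case True
        then show ?thesis by (subst ennreal_mult''[symmetric]) auto
      qed (use elim in auto)
    qed
  qed
  also have "\<dots> = ennreal ((t / 2) ^ Suc r / fact (Suc r) - (0 / 2) ^ Suc r / fact (Suc r))"
  proof (rule nn_integral_FTC_Icc)
    show "((\<lambda>s. (s / 2) ^ Suc r / fact (Suc r)) has_real_derivative 1 / 2 * ((s / 2) ^ r / fact r)) (at s)" for s
      by (rule derivative_eq_intros refl | simp add: field_simps del: of_nat_Suc)+
  qed (use assms in auto)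
  finally show ?thesis by simp
qed

text \<open>All exponents being 1, the sum is an \<open>r\<close>-fold iterated integral of the
  constant 1 against \<open>ds / 2\<close>.\<close>

lemma alt_sum_ones_tanh:
  assumes "0 \<le> t"
  shows "alt_sum (replicate r 1) (\<lambda>M. ennreal (tanh (t / 2) ^ M)) = ennreal ((t / 2) ^ r / fact r)"
  using assms
proof (induction r arbitrary: t)
  case (Suc r)
  have "replicate (Suc r) 1 = replicate r 1 @ [1::nat]"
    by (simp add: replicate_append_same)
  then have "alt_sum (replicate (Suc r) 1) (\<lambda>M. ennreal (tanh (t / 2) ^ M))
      = alt_sum (replicate r 1) (\<lambda>N. \<integral>\<^sup>+s\<in>{0<..<t}. ennreal (1 / 2) * ennreal (tanh (s / 2) ^ N) \<partial>lborel)"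
    by (simp only: alt_sum_snoc odd_tail_tanh[OF Suc.prems, abs_def])
  also have "\<dots> = (\<integral>\<^sup>+s\<in>{0<..<t}. ennreal (1 / 2) * alt_sum (replicate r 1) (\<lambda>N. ennreal (tanh (s / 2) ^ N)) \<partial>lborel)"
    by (rule set_nn_integral_mult_alt_sum[symmetric]) measurable
  also have "\<dots> = (\<integral>\<^sup>+s\<in>{0<..<t}. ennreal (1 / 2) * ennreal ((s / 2) ^ r / fact r) \<partial>lborel)"
  proof (intro nn_integral_cong)
    fix s
    show "ennreal (1 / 2) * alt_sum (replicate r 1) (\<lambda>N. ennreal (tanh (s / 2) ^ N)) * indicator {0<..<t} s
        = ennreal (1 / 2) * ennreal ((s / 2) ^ r / fact r) * indicator {0<..<t} s"
      using Suc.IH[of s] by (cases "0 < s \<and> s < t") auto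
  qed
  also have "\<dots> = ennreal ((t / 2) ^ Suc r / fact (Suc r))"
    by (rule nn_integral_power_half[OF Suc.prems])
  finally show ?case .
qed simp

lemma Ath_ones_0:
  assumes "0 \<le> t"
  shows "Ath_ones r 0 t = ennreal ((t / 2) ^ Suc r / fact (Suc r))"
  using alt_sum_ones_tanh[OF assms, of "Suc r"]
  by (simp add: Ath_ones_def replicate_append_same)

lemma Ath_ones_le: "Ath_ones r q t \<le> Ath_ones r 0 t"
  unfolding Ath_ones_def
  by (intro alt_sum_antimono_exponents list_all2_appendI) (auto simp: list_all2_conv_all_nth)

text \<open>Tonelli on the region \<open>0 < s < t\<close>.\<close>

lemma nn_integral_triangle_swap:
  fixes f g :: "real \<Rightarrow> ennreal"
  assumes [measurable]: "f \<in> borel_measurable borel" "g \<in> borel_measurable borel"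
  shows "(\<integral>\<^sup>+t\<in>{0<..}. g t * (\<integral>\<^sup>+s\<in>{0<..<t}. f s \<partial>lborel) \<partial>lborel)
       = (\<integral>\<^sup>+s\<in>{0<..}. (\<integral>\<^sup>+t\<in>{s<..}. g t \<partial>lborel) * f s \<partial>lborel)"
proof -
  let ?F = "\<lambda>s t :: real. if 0 < s \<and> s < t then g t * f s else (0::ennreal)"
  have [measurable]: "(\<lambda>(s, t). ?F s t) \<in> borel_measurable (lborel \<Otimes>\<^sub>M lborel)"
    by measurable
  have "(\<integral>\<^sup>+t\<in>{0<..}. g t * (\<integral>\<^sup>+s\<in>{0<..<t}. f s \<partial>lborel) \<partial>lborel)
      = (\<integral>\<^sup>+t. (\<integral>\<^sup>+s. ?F s t \<partial>lborel) \<partial>lborel)"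
  proof (intro nn_integral_cong)
    fix t :: real
    show "g t * (\<integral>\<^sup>+s\<in>{0<..<t}. f s \<partial>lborel) * indicator {0<..} t = (\<integral>\<^sup>+s. ?F s t \<partial>lborel)"
    proof (cases "0 < t")
      case True
      then show ?thesis
        by (auto simp: nn_integral_cmult[symmetric] intro!: nn_integral_cong split: split_indicator)
    next
      case False
      then have "?F s t = 0" for s by auto
      with False show ?thesis by simp
    qed
  qed
  also have "\<dots> = (\<integral>\<^sup>+s. (\<integral>\<^sup>+t. ?F s t \<partial>lborel) \<partial>lborel)"
    by (rule lborel_pair.Fubini') measurable
  also have "\<dots> = (\<integral>\<^sup>+s\<in>{0<..}. (\<integral>\<^sup>+t\<in>{s<..}. g t \<partial>lborel) * f s \<partial>lborel)"
    by (intro nn_integral_cong)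
      (auto simp: nn_integral_multc[symmetric] intro!: nn_integral_cong split: split_indicator)
  finally show ?thesis .
qed

text \<open>One integration is moved from the \<open>Ath\<close> factor to the tail factor;
  iterating this reduces the \<open>Ath\<close> factor to a pure power of \<open>t\<close>.\<close>

lemma nn_integral_tail_Ath_ones_Suc:
  "(\<integral>\<^sup>+t\<in>{0<..}. tail_integral m p t * ennreal (1 / sinh t) * Ath_ones r (Suc q) t \<partial>lborel)
 = (\<integral>\<^sup>+t\<in>{0<..}. tail_integral m (Suc p) t * ennreal (1 / sinh t) * Ath_ones r q t \<partial>lborel)"
proof -
  have "(\<integral>\<^sup>+t\<in>{0<..}. tail_integral m p t * ennreal (1 / sinh t) * Ath_ones r (Suc q) t \<partial>lborel)
      = (\<integral>\<^sup>+t\<in>{0<..}. tail_integral m p t * ennreal (1 / sinh t) *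
          (\<integral>\<^sup>+s\<in>{0<..<t}. ennreal (1 / sinh s) * Ath_ones r q s \<partial>lborel) \<partial>lborel)"
    by (intro nn_integral_cong) (auto simp: nn_integral_Ath_ones split: split_indicator)
  also have "\<dots> = (\<integral>\<^sup>+s\<in>{0<..}. (\<integral>\<^sup>+t\<in>{s<..}. tail_integral m p t * ennreal (1 / sinh t) \<partial>lborel) *
      (ennreal (1 / sinh s) * Ath_ones r q s) \<partial>lborel)"
    by (rule nn_integral_triangle_swap) measurable
  also have "\<dots> = (\<integral>\<^sup>+s\<in>{0<..}. tail_integral m (Suc p) s * ennreal (1 / sinh s) * Ath_ones r q s \<partial>lborel)"
  proof (intro nn_integral_cong)
    fix s :: real
    show "(\<integral>\<^sup>+t\<in>{s<..}. tail_integral m p t * ennreal (1 / sinh t) \<partial>lborel) *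
        (ennreal (1 / sinh s) * Ath_ones r q s) * indicator {0<..} s
      = tail_integral m (Suc p) s * ennreal (1 / sinh s) * Ath_ones r q s * indicator {0<..} s"
    proof (cases "0 < s")
      case True
      then have "0 \<le> s" by simp
      show ?thesis unfolding nn_integral_tail_integral[OF \<open>0 \<le> s\<close>] by (simp add: mult.assoc)
    qed simp
  qed
  finally show ?thesis .
qed

lemma nn_integral_tail_Ath_ones:
  "(\<integral>\<^sup>+t\<in>{0<..}. tail_integral m p t * ennreal (1 / sinh t) * Ath_ones r q t \<partial>lborel)
 = (\<integral>\<^sup>+t\<in>{0<..}. tail_integral m (p + q) t * ennreal (1 / sinh t) * Ath_ones r 0 t \<partial>lborel)"
  by (induction q arbitrary: p) (simp_all add: nn_integral_tail_Ath_ones_Suc)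

lemma enn2real_power: "enn2real (x ^ n) = enn2real x ^ n"
  by (induction n) (simp_all add: enn2real_mult)

text \<open>The case \<open>s = 0\<close>, where only \<open>j = 0\<close> survives because
  \<open>0 ^ 0 = 1\<close>.\<close>

lemma nn_integral_power_alt_sum_0:
  "(\<integral>\<^sup>+t\<in>{0<..}. ennreal (t ^ b / fact b) *
      alt_sum es (\<lambda>M. ennreal (exp (- real M * t))) * ennreal (1 / sinh t) \<partial>lborel)
   = 2 * alt_sum (es @ [Suc b]) (\<lambda>_. 1)"
proof -
  have "(\<Sum>j\<le>b. ennreal (0 ^ j / fact j) *
            (2 * alt_sum (es @ [Suc (b - j)]) (\<lambda>M. ennreal (exp (- real M * 0)))))
      = (\<Sum>j\<le>b. if j = 0 then 2 * alt_sum (es @ [Suc b]) (\<lambda>_. 1) else 0)"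
    by (intro sum.cong) auto
  then show ?thesis
    using nn_integral_power_alt_sum[of 0 b es] by simp
qed

lemma nn_integral_tail_power:
  "(\<integral>\<^sup>+t\<in>{0<..}. tail_integral m q t * ennreal (1 / sinh t) * ennreal (t ^ r / fact r) \<partial>lborel)
 = (\<Sum>a\<in>comps (Suc q) m. of_nat ((last a + r) choose r) *
     (2 ^ Suc q * alt_sum (map Suc (butlast a) @ [Suc (last a + r)]) (\<lambda>_. 1)))"
proof -
  let ?E = "\<lambda>es t. alt_sum es (\<lambda>M. ennreal (exp (- real M * t)))"
  \<comment> \<open>This product is the source of the binomial coefficients. The index
    \<open>b\<close> will become the last entry of the composition.\<close>
  have binom: "ennreal (t ^ b / fact b) * ennreal (t ^ r / fact r)
      = of_nat ((b + r) choose r) * ennreal (t ^ (b + r) / fact (b + r))" if "0 \<le> t" for t b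
  proof -
    have "t ^ b / fact b * (t ^ r / fact r) = real ((b + r) choose r) * (t ^ (b + r) / fact (b + r))"
      using binomial_fact[of r "b + r", where 'a = real] by (simp add: power_add)
    then show ?thesis
      using that by (simp add: ennreal_mult''[symmetric] ennreal_of_nat_eq_real_of_nat)
  qed
  have "(\<integral>\<^sup>+t\<in>{0<..}. tail_integral m q t * ennreal (1 / sinh t) * ennreal (t ^ r / fact r) \<partial>lborel)
      = (\<integral>\<^sup>+t. (\<Sum>b\<le>m. \<Sum>c\<in>comps q (m - b). of_nat ((b + r) choose r) * 2 ^ q *
          (ennreal (t ^ (b + r) / fact (b + r)) * ?E (map Suc c) t * ennreal (1 / sinh t) * indicator {0<..} t)) \<partial>lborel)"
  proof (intro nn_integral_cong)
    fix t :: real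
    show "tail_integral m q t * ennreal (1 / sinh t) * ennreal (t ^ r / fact r) * indicator {0<..} t
      = (\<Sum>b\<le>m. \<Sum>c\<in>comps q (m - b). of_nat ((b + r) choose r) * 2 ^ q *
          (ennreal (t ^ (b + r) / fact (b + r)) * ?E (map Suc c) t * ennreal (1 / sinh t) * indicator {0<..} t))"
    proof (cases "0 < t")
      case True
      then have b: "ennreal (t ^ b / fact b) * x * (y * ennreal (t ^ r / fact r))
         = of_nat ((b + r) choose r) * (ennreal (t ^ (b + r) / fact (b + r)) * (x * y))" for b x y
        using arg_cong[OF binom[of t b], of "\<lambda>z. z * (x * y)"] by (simp add: ac_simps)
      have "tail_integral m q t * ennreal (1 / sinh t) * ennreal (t ^ r / fact r)
        = (\<Sum>b\<le>m. of_nat ((b + r) choose r) * (ennreal (t ^ (b + r) / fact (b + r)) *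
            (2 ^ q * (\<Sum>c\<in>comps q (m - b). ?E (map Suc c) t) * ennreal (1 / sinh t))))"
        unfolding tail_integral_def mult.assoc[of _ "ennreal (1 / sinh t)"] sum_distrib_right b ..
      also have "\<dots> = (\<Sum>b\<le>m. \<Sum>c\<in>comps q (m - b). of_nat ((b + r) choose r) * 2 ^ q *
          (ennreal (t ^ (b + r) / fact (b + r)) * ?E (map Suc c) t * ennreal (1 / sinh t)))"
        by (simp only: sum_distrib_left sum_distrib_right ac_simps)
      finally show ?thesis using True by simp
    qed simp
  qed
  also have "\<dots> = (\<Sum>b\<le>m. \<Sum>c\<in>comps q (m - b). of_nat ((b + r) choose r) * 2 ^ q *
      (\<integral>\<^sup>+t\<in>{0<..}. ennreal (t ^ (b + r) / fact (b + r)) * ?E (map Suc c) t * ennreal (1 / sinh t) \<partial>lborel))"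
    by (rule nn_integral_double_sum) measurable
  also have "\<dots> = (\<Sum>a\<in>comps (Suc q) m. of_nat ((last a + r) choose r) *
     (2 ^ Suc q * alt_sum (map Suc (butlast a) @ [Suc (last a + r)]) (\<lambda>_. 1)))"
    unfolding nn_integral_power_alt_sum_0 sum_comps_Suc
    by (simp add: ac_simps)
  finally show ?thesis .
qed

text \<open>All \<open>q\<close> integrations are moved onto \<open>t ^ m / fact m\<close>, which is
  \<open>tail_integral m 0\<close>. The factor \<open>2 ^ Suc r\<close> clears the denominators of
  \<open>(t / 2) ^ Suc r\<close>.\<close>

lemma nn_integral_power_Ath_ones:
  "2 ^ Suc r * (\<integral>\<^sup>+t\<in>{0<..}. ennreal (t ^ m / fact m) * ennreal (1 / sinh t) * Ath_ones r q t \<partial>lborel)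
 = (\<Sum>a\<in>comps (Suc q) m. of_nat ((last a + Suc r) choose Suc r) *
     (2 ^ Suc q * alt_sum (map Suc (butlast a) @ [Suc (last a + Suc r)]) (\<lambda>_. 1)))"
proof -
  have "2 ^ Suc r * (\<integral>\<^sup>+t\<in>{0<..}. ennreal (t ^ m / fact m) * ennreal (1 / sinh t) * Ath_ones r q t \<partial>lborel)
      = 2 ^ Suc r * (\<integral>\<^sup>+t\<in>{0<..}. tail_integral m q t * ennreal (1 / sinh t) * Ath_ones r 0 t \<partial>lborel)"
    using nn_integral_tail_Ath_ones[of m 0 r q] by (simp add: tail_integral_0)
  also have "\<dots> = (\<integral>\<^sup>+t. 2 ^ Suc r * (tail_integral m q t * ennreal (1 / sinh t) * Ath_ones r 0 t * indicator {0<..} t) \<partial>lborel)"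
    by (rule nn_integral_cmult[symmetric]) measurable
  also have "\<dots> = (\<integral>\<^sup>+t\<in>{0<..}. tail_integral m q t * ennreal (1 / sinh t) * ennreal (t ^ Suc r / fact (Suc r)) \<partial>lborel)"
  proof (intro nn_integral_cong)
    fix t :: real
    show "2 ^ Suc r * (tail_integral m q t * ennreal (1 / sinh t) * Ath_ones r 0 t * indicator {0<..} t)
      = tail_integral m q t * ennreal (1 / sinh t) * ennreal (t ^ Suc r / fact (Suc r)) * indicator {0<..} t"
    proof (cases "0 < t")
      case True
      have "2 ^ Suc r * ennreal ((t / 2) ^ Suc r / fact (Suc r)) = ennreal (2 ^ Suc r * ((t / 2) ^ Suc r / fact (Suc r)))"
        using True by (subst ennreal_mult'') (auto simp del: power_Suc fact_Suc simp: ennreal_power[symmetric])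
      also have "2 ^ Suc r * ((t / 2) ^ Suc r / fact (Suc r)) = t ^ Suc r / fact (Suc r)"
        by (simp add: power_divide del: power_Suc fact_Suc)
      finally show ?thesis
        using True by (simp add: Ath_ones_0 mult.left_commute[of "2 ^ Suc r"] mult.assoc
            del: power_Suc fact_Suc)
    qed simp
  qed
  also have "\<dots> = (\<Sum>a\<in>comps (Suc q) m. of_nat ((last a + Suc r) choose Suc r) *
     (2 ^ Suc q * alt_sum (map Suc (butlast a) @ [Suc (last a + Suc r)]) (\<lambda>_. 1)))"
    by (rule nn_integral_tail_power)
  finally show ?thesis .
qed

section \<open>Convergence of the series\<close>

lemma alt_sum_2_finite: "alt_sum [2] (\<lambda>_. 1) < top"
proof -
  have "summable (\<lambda>n. 1 / (real n + 1)\<^sup>2)"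
    using inverse_squares_sums by (simp add: sums_iff add.commute)
  then have sm: "summable (\<lambda>n. 1 / (real (2 * n + 1))\<^sup>2)"
    by (rule summable_comparison_test') (auto intro!: divide_left_mono power_mono)
  have "alt_sum [2] (\<lambda>_. 1) = (\<Sum>n. ennreal (1 / (real (2 * n + 1))\<^sup>2))"
    by (simp add: alt_sum_def odd_tail_def)
  also have "\<dots> = ennreal (\<Sum>n. 1 / (real (2 * n + 1))\<^sup>2)"
    by (rule suminf_ennreal2[OF _ sm]) simp
  finally show ?thesis by simp
qed

text \<open>
  The depth-one identity dominates the one of depth \<open>q + 1\<close> term by term, so convergence of
  \<open>T(1, \<dots>, 1, 2)\<close> comes down to that of \<open>T(2)\<close>.
\<close>

lemma alt_sum_ones_2_finite: "alt_sum (replicate q 1 @ [2]) (\<lambda>_. 1) < top"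
proof -
  \<comment> \<open>For \<open>m = 0\<close> only the zero composition is left, so the identity
    reduces to a single sum with exponents \<open>1, ..., 1, 2\<close>.\<close>
  have comps: "comps (Suc q) 0 = {replicate (Suc q) 0}" for q
    by (auto simp: sum_list_eq_0_iff replicate_eqI) (metis length_replicate replicate_eqI replicate_Suc)
  have eq: "2 * (\<integral>\<^sup>+t\<in>{0<..}. ennreal (1 / sinh t) * Ath_ones 0 q t \<partial>lborel)
      = 2 ^ Suc q * alt_sum (replicate q 1 @ [2]) (\<lambda>_. 1)" for q
    using nn_integral_power_Ath_ones[of 0 0 q] unfolding comps
    by (simp add: butlast_conv_take take_replicate map_replicate_const numeral_2_eq_2 del: replicate_Suc)
  have "alt_sum (replicate q 1 @ [2]) (\<lambda>_. 1) \<le> 2 ^ Suc q * alt_sum (replicate q 1 @ [2]) (\<lambda>_. 1)"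
    using mult_right_mono[of 1 "2 ^ Suc q :: ennreal"] by (simp add: one_le_power del: power_Suc)
  also have "\<dots> = 2 * (\<integral>\<^sup>+t\<in>{0<..}. ennreal (1 / sinh t) * Ath_ones 0 q t \<partial>lborel)"
    by (rule eq[symmetric])
  also have "\<dots> \<le> 2 * (\<integral>\<^sup>+t\<in>{0<..}. ennreal (1 / sinh t) * Ath_ones 0 0 t \<partial>lborel)"
    by (intro mult_left_mono nn_integral_mono mult_right_mono Ath_ones_le) auto
  also have "\<dots> = 2 * alt_sum [2] (\<lambda>_. 1)"
    using eq[of 0] by simp
  also have "\<dots> < top"
    using alt_sum_2_finite by (simp add: ennreal_mult_less_top)
  finally show ?thesis .
qed

lemma alt_sum_finite:
  assumes "2 \<le> e"
  shows "alt_sum (map Suc c @ [e]) (\<lambda>_. 1) < top"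
proof -
  have "alt_sum (map Suc c @ [e]) (\<lambda>_. 1) \<le> alt_sum (replicate (length c) 1 @ [2]) (\<lambda>_. 1)"
    using assms
    by (intro alt_sum_antimono_exponents list_all2_appendI) (auto simp: list_all2_conv_all_nth)
  then show ?thesis
    using alt_sum_ones_2_finite le_less_trans by blast
qed

subsection \<open>Passage to complex values\<close>

lemma infsum_of_real_eq_enn2real:
  assumes "\<And>x. x \<in> A \<Longrightarrow> 0 \<le> f x"
  shows "(\<Sum>\<^sub>\<infinity>x\<in>A. complex_of_real (f x)) = of_real (enn2real (\<integral>\<^sup>+x. ennreal (f x) \<partial>count_space A))"
proof -
  have eq: "infsum f A = enn2real (\<integral>\<^sup>+x. ennreal (f x) \<partial>count_space A)"
    by (rule infsum_eq_enn2real_nn_integral) (rule assms)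
  show ?thesis
  proof (cases "f summable_on A")
    case True
    then show ?thesis
      using infsumI[OF has_sum_of_real[OF has_sum_infsum]] eq by metis
  next
    case False
    then have "\<not> (\<lambda>x. complex_of_real (f x)) summable_on A"
      using summable_on_Re by fastforce
    with False show ?thesis
      unfolding eq[symmetric] by (simp add: infsum_not_exists)
  qed
qed

lemma infsum_alt_seqs:
  assumes "es \<noteq> []" and "\<And>M. 0 \<le> f M"
  shows "(\<Sum>\<^sub>\<infinity>ms\<in>alt_seqs (length es). complex_of_real (f (last ms) / (\<Prod>i<length es. real (ms ! i) ^ (es ! i))))
       = of_real (enn2real (alt_sum es (\<lambda>M. ennreal (f M))))"
proof -
  have "(\<integral>\<^sup>+ms. ennreal (f (last ms) / (\<Prod>i<length es. real (ms ! i) ^ (es ! i))) \<partial>count_space (alt_seqs (length es)))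
      = alt_sum es (\<lambda>M. ennreal (f M))"
    unfolding nn_integral_alt_seqs[symmetric]
  proof (intro nn_integral_cong)
    fix ms assume "ms \<in> space (count_space (alt_seqs (length es)))"
    \<comment> \<open>For nonempty \<open>ms\<close> the value \<open>last (0 # ms)\<close> is
      \<open>last ms\<close>.\<close>
    then have "ms \<noteq> []" using assms(1) by (auto simp: alt_seqs_def)
    then show "ennreal (f (last ms) / (\<Prod>i<length es. real (ms ! i) ^ (es ! i)))
        = (\<Prod>i<length es. ennreal (1 / real (ms ! i) ^ (es ! i))) * ennreal (f (last (0 # ms)))"
      using assms(2) by (simp add: prod_ennreal prod_dividef ennreal_mult''[symmetric])
  qed
  then show ?thesis
    using assms(2) by (subst infsum_of_real_eq_enn2real) (auto intro!: divide_nonneg_nonneg prod_nonneg)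
qed

lemma Ath_of_real:
  assumes "ks \<noteq> []" and "0 \<le> x"
  shows "Ath (map int ks) (of_real x) = of_real (enn2real (alt_sum ks (\<lambda>M. ennreal (x ^ M))))"
proof -
  have "Ath (map int ks) (of_real x) = (\<Sum>\<^sub>\<infinity>ms\<in>alt_seqs (length ks).
      complex_of_real (x ^ last ms / (\<Prod>i<length ks. real (ms ! i) ^ (ks ! i))))"
    unfolding Ath_def length_map
  proof (rule infsum_cong)
    fix ms
    have "(\<Prod>i<length ks. complex_of_nat (ms ! i) powi (map int ks ! i))
        = of_real (\<Prod>i<length ks. real (ms ! i) ^ (ks ! i))"
      unfolding of_real_prod by (intro prod.cong) auto
    then show "of_real x ^ last ms / (\<Prod>i<length ks. complex_of_nat (ms ! i) powi (map int ks ! i))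
        = of_real (x ^ last ms / (\<Prod>i<length ks. real (ms ! i) ^ (ks ! i)))"
      by simp
  qed
  also have "\<dots> = of_real (enn2real (alt_sum ks (\<lambda>M. ennreal (x ^ M))))"
    by (rule infsum_alt_seqs) (use assms in auto)
  finally show ?thesis .
qed

lemma T_fun_of_nat:
  "T_fun ks (of_nat e) = of_real (2 ^ Suc (length ks) * enn2real (alt_sum (ks @ [e]) (\<lambda>_. 1)))"
proof -
  have "(\<Sum>\<^sub>\<infinity>ms\<in>alt_seqs (Suc (length ks)).
       1 / ((\<Prod>i<length ks. of_nat (ms ! i) ^ (ks ! i)) * of_nat (ms ! length ks) powr (of_nat e :: complex)))
     = (\<Sum>\<^sub>\<infinity>ms\<in>alt_seqs (Suc (length ks)). complex_of_real (1 / (\<Prod>i<length (ks @ [e]). real (ms ! i) ^ ((ks @ [e]) ! i))))"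
  proof (rule infsum_cong)
    fix ms assume "ms \<in> alt_seqs (Suc (length ks))"
    \<comment> \<open>For a nonzero base, \<open>powr\<close> with a natural exponent is the
      ordinary power.\<close>
    then have "ms ! length ks \<noteq> 0" by (auto simp: alt_seqs_def)
    then show "1 / ((\<Prod>i<length ks. of_nat (ms ! i) ^ (ks ! i)) * of_nat (ms ! length ks) powr (of_nat e :: complex))
        = complex_of_real (1 / (\<Prod>i<length (ks @ [e]). real (ms ! i) ^ ((ks @ [e]) ! i)))"
      by (simp add: nth_append)
  qed
  also have "\<dots> = of_real (enn2real (alt_sum (ks @ [e]) (\<lambda>_. 1)))"
    using infsum_alt_seqs[of "ks @ [e]" "\<lambda>_. 1"] by simp
  finally show ?thesis
    by (simp add: T_fun_def)
qed

text \<open>As \<open>Gamma (m + 1) = fact m\<close>, the prefactor of the integral normalizes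
  \<open>t ^ m\<close> to \<open>t ^ m / fact m\<close>.\<close>

lemma psi_fun_of_nat:
  "psi_fun (replicate r 1 @ [Suc q]) (of_nat (m + 1)) = of_real (enn2real (2 ^ Suc r *
     (\<integral>\<^sup>+t\<in>{0<..}. ennreal (t ^ m / fact m) * ennreal (1 / sinh t) * Ath_ones r q t \<partial>lborel)))"
proof -
  let ?ks = "replicate r 1 @ [Suc q]"
  let ?g = "\<lambda>t. indicator {0<..} t * (t ^ m * enn2real (Ath_ones r q t) / sinh t)"
  \<comment> \<open>Pointwise finiteness, by comparison with the explicit power of \<open>t\<close>
    for last exponent 1, allows \<open>enn2real\<close> to be undone inside the integral.\<close>
  have finite: "Ath_ones r q t < top" if "0 < t" for t
    using Ath_ones_le[of r q t] that by (simp add: Ath_ones_0 less_imp_le le_less_trans)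
  have "(CLBINT t:{0<..}. of_real t powr (of_nat (m + 1) - 1) *
        Ath (map int ?ks) (of_real (tanh (t / 2))) / of_real (sinh t)) = (LINT t|lborel. complex_of_real (?g t))"
    unfolding set_lebesgue_integral_def
  proof (rule Bochner_Integration.integral_cong[OF refl])
    fix t :: real
    show "indicator {0<..} t *\<^sub>R (of_real t powr (of_nat (m + 1) - 1) *
        Ath (map int ?ks) (of_real (tanh (t / 2))) / of_real (sinh t)) = complex_of_real (?g t)"
    proof (cases "0 < t")
      case True
      then have "Ath (map int ?ks) (of_real (tanh (t / 2))) = of_real (enn2real (Ath_ones r q t))"
        unfolding Ath_ones_def by (intro Ath_of_real) auto
      with True show ?thesis by simp
    qed simp
  qed
  also have "\<dots> = of_real (enn2real (\<integral>\<^sup>+t. ennreal (?g t) \<partial>lborel))"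
    by (subst integral_complex_of_real, subst integral_eq_nn_integral) (auto split: split_indicator)
  also have "(\<integral>\<^sup>+t. ennreal (?g t) \<partial>lborel) = (\<integral>\<^sup>+t. ennreal (fact m) *
     (ennreal (t ^ m / fact m) * ennreal (1 / sinh t) * Ath_ones r q t * indicator {0<..} t) \<partial>lborel)"
  proof (intro nn_integral_cong)
    fix t :: real
    show "ennreal (?g t) = ennreal (fact m) *
      (ennreal (t ^ m / fact m) * ennreal (1 / sinh t) * Ath_ones r q t * indicator {0<..} t)"
    proof (cases "0 < t")
      case True
      define A where "A = enn2real (Ath_ones r q t)"
      have A: "Ath_ones r q t = ennreal A" "0 \<le> A"
        using finite[OF True] by (auto simp: A_def)
      show ?thesis
        using True A by (simp add: ennreal_mult''[symmetric] A_def[symmetric] field_simps)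
    qed simp
  qed
  also have "\<dots> = ennreal (fact m) *
     (\<integral>\<^sup>+t\<in>{0<..}. ennreal (t ^ m / fact m) * ennreal (1 / sinh t) * Ath_ones r q t \<partial>lborel)"
    by (rule nn_integral_cmult) measurable
  finally show ?thesis
    unfolding psi_fun_def using Gamma_fact[of m, where 'a = complex]
    by (simp add: enn2real_mult add.commute enn2real_power)
qed

theorem theorem5p7:
  fixes r k m :: nat
  assumes "r \<ge> 1" and "k \<ge> 1"
  shows "psi_fun (replicate (r - 1) 1 @ [k]) (of_nat (m + 1)) =
    (\<Sum>a\<in>{a :: nat list. length a = k \<and> sum_list a = m}.
       of_nat ((a ! (k - 1) + r) choose r) *
       T_fun (map (\<lambda>i. a ! i + 1) [0..<k - 1]) (of_nat (a ! (k - 1) + r + 1)))"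
proof -
  \<comment> \<open>\<open>R\<close> counts the leading ones and \<open>q\<close> the integrations
    to be moved.\<close>
  obtain R q where [simp]: "r = Suc R" "k = Suc q"
    using assms by (metis Suc_pred' less_eq_Suc_le One_nat_def)
  let ?S = "\<lambda>a. alt_sum (map Suc (butlast a) @ [Suc (last a + r)]) (\<lambda>_. 1)"
  \<comment> \<open>Additivity of \<open>enn2real\<close> over the compositions requires finite
    summands. The last exponent is at least 2 because \<open>r\<close> is positive.\<close>
  have finite: "of_nat ((last a + r) choose r) * (2 ^ k * ?S a) < top" for a
    using alt_sum_finite[of "Suc (last a + r)" "butlast a"]
    by (simp add: ennreal_mult_less_top power_less_top_ennreal of_nat_less_top)
  have "psi_fun (replicate (r - 1) 1 @ [k]) (of_nat (m + 1))
      = of_real (enn2real (\<Sum>a\<in>comps k m. of_nat ((last a + r) choose r) * (2 ^ k * ?S a)))"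
    using psi_fun_of_nat[of R q m] unfolding nn_integral_power_Ath_ones by simp
  also have "\<dots> = (\<Sum>a\<in>comps k m. of_nat ((last a + r) choose r) * of_real (2 ^ k * enn2real (?S a)))"
    by (subst enn2real_sum, rule finite)
      (simp only: comp_def enn2real_mult enn2real_of_nat enn2real_power enn2real_numeral
        of_real_sum of_real_mult of_real_of_nat_eq)
  also have "\<dots> = (\<Sum>a\<in>comps k m. of_nat ((a ! (k - 1) + r) choose r) *
       T_fun (map (\<lambda>i. a ! i + 1) [0..<k - 1]) (of_nat (a ! (k - 1) + r + 1)))"
  proof (rule sum.cong[OF refl])
    fix a assume "a \<in> comps k m"
    then have len: "length a = Suc q" by simp
    then have "a \<noteq> []" by auto
    then have last: "last a = a ! (k - 1)" using len by (simp add: last_conv_nth)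
    have butlast: "map Suc (butlast a) = map (\<lambda>i. a ! i + 1) [0..<k - 1]"
      using len by (intro nth_equalityI) (auto simp: nth_butlast)
    show "of_nat ((last a + r) choose r) * of_real (2 ^ k * enn2real (?S a)) =
        of_nat ((a ! (k - 1) + r) choose r) *
        T_fun (map (\<lambda>i. a ! i + 1) [0..<k - 1]) (of_nat (a ! (k - 1) + r + 1))"
      unfolding T_fun_of_nat butlast last by simp
  qed
  finally show ?thesis .
qed

end
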